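(* Let $Z>0$ be a random variable with distribution function $G$ and Laplace transform $\varphi$, and let $\omega$ be the characteristic function of an infinitely divisible law on $\mathbb{R}$, so that $\omega^s$ is a characteristic function for every $s>0$. If the parameter $s$ in $\omega^s$ is randomized by assigning to it the distribution function $G$, then the resulting distribution (the mixture of the laws with characteristic functions $\omega^s$, $s>0$, with mixing distribution $G$) has characteristic function $\varphi\{-\log\omega\}$, i.e. the function $u\mapsto\varphi(-\log\omega(u))$, $u\in\mathbb{R}$.
   Context: A characteristic function $\omega$ is infinitely divisible iff $\omega^s$ is a characteristic function for every $s>0$; in that case $\omega$ has no real zero. Here $\log\omega$ is the continuous logarithm with $\log\omega(0)=0$, and $\omega^s=\exp\{s\log\omega\}$. The Laplace transform of $Z$ is $\varphi(v)=E[e^{-vZ}]=\int_0^\infty e^{-vs}\,dG(s)$, defined for all complex $v$ with $\mathrm{Re}\,v\ge 0$. *)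

theory Defs
  imports "HOL-Probability.Probability"
begin

definition is_chf :: "(real \<Rightarrow> complex) \<Rightarrow> bool" where
  "is_chf f \<longleftrightarrow> (\<exists>M. real_distribution M \<and> char M = f)"

text \<open>Unique for a characteristic function by \<open>Levy_uniqueness\<close>.\<close>

definition law_of_chf :: "(real \<Rightarrow> complex) \<Rightarrow> real measure" where
  "law_of_chf f = (THE M. real_distribution M \<and> char M = f)"

text \<open>The continuous logarithm, not the pointwise principal branch \<^const>\<open>Ln\<close>.\<close>

definition cont_log :: "(real \<Rightarrow> complex) \<Rightarrow> real \<Rightarrow> complex" where
  "cont_log f = (THE L. continuous_on UNIV L \<and> L 0 = 0 \<and> (\<forall>u. exp (L u) = f u))"

definition chf_power :: "(real \<Rightarrow> complex) \<Rightarrow> real \<Rightarrow> real \<Rightarrow> complex" where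
  "chf_power f s = (\<lambda>u. exp (complex_of_real s * cont_log f u))"

text \<open>The absence of zeros is what makes \<open>cont_log\<close>, hence \<open>chf_power\<close>, meaningful
  (see \<open>cont_log_ex1\<close> below).\<close>

definition infinitely_divisible_chf :: "(real \<Rightarrow> complex) \<Rightarrow> bool" where
  "infinitely_divisible_chf f \<longleftrightarrow>
     is_chf f \<and> (\<forall>u. f u \<noteq> 0) \<and> (\<forall>s>0. is_chf (chf_power f s))"

text \<open>Used for \<open>Re v \<ge> 0\<close> only; the Bochner integral is \<open>0\<close> where it does not exist.\<close>

definition laplace_transform :: "'a measure \<Rightarrow> ('a \<Rightarrow> real) \<Rightarrow> complex \<Rightarrow> complex" where
  "laplace_transform P Z v = (CLINT x|P. exp (- v * complex_of_real (Z x)))"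

text \<open>The measure \<open>B \<mapsto> \<integral> K s B dG(s)\<close> over \<open>s > 0\<close>. The mixing measure is restricted to
  \<open>{0<..}\<close>, where the kernel is meaningful; for a distribution function \<open>G\<close> of a positive random
  variable nothing is lost.\<close>

definition mixture :: "(real \<Rightarrow> real) \<Rightarrow> (real \<Rightarrow> real measure) \<Rightarrow> real measure" where
  "mixture G K = restrict_space (interval_measure G) {0<..} \<bind> K"

lemma law_of_chf:
  assumes "is_chf f"
  shows "real_distribution (law_of_chf f)" "char (law_of_chf f) = f"
proof -
  have "\<exists>!M. real_distribution M \<and> char M = f"
    using assms Levy_uniqueness unfolding is_chf_def by blast
  from theI'[OF this] show "real_distribution (law_of_chf f)" "char (law_of_chf f) = f"
    unfolding law_of_chf_def by blast+
qed

lemma cont_log_ex1: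
  fixes f :: "real \<Rightarrow> complex"
  assumes "continuous_on UNIV f" "f 0 = 1" "\<And>u. f u \<noteq> 0"
  shows "\<exists>!L. continuous_on UNIV L \<and> L 0 = 0 \<and> (\<forall>u. exp (L u) = f u)"
proof -
  obtain g where g: "continuous_on UNIV g" "\<And>x. f x = exp (g x)"
    using continuous_logarithm_on_contractible[of UNIV f] assms
    by (metis UNIV_I contractible_UNIV)
  show ?thesis
  proof (rule ex1I[of _ "\<lambda>u. g u - g 0"])
    have "exp (g 0) = 1"
      using g(2)[of 0] assms(2) by simp
    then show "continuous_on UNIV (\<lambda>u. g u - g 0) \<and> g 0 - g 0 = 0 \<and> (\<forall>u. exp (g u - g 0) = f u)"
      using g by (auto intro!: continuous_intros simp: exp_diff)
  next
    fix L assume L: "continuous_on UNIV L \<and> L 0 = 0 \<and> (\<forall>u. exp (L u) = f u)"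
    define D where "D u = L u - g u" for u
    have D1: "exp (D u) = 1" for u
      using L g(2)[of u] by (simp add: D_def exp_diff)
    have "D constant_on UNIV"
    proof (rule continuous_discrete_range_constant)
      show "continuous_on UNIV D"
        unfolding D_def using L g by (intro continuous_intros) auto
      fix x
      have "2 * pi \<le> norm (D y - D x)" if "D y \<noteq> D x" for y
      proof -
        have "exp (D y - D x) = 1"
          by (simp add: exp_diff D1)
        then obtain n :: int where n: "Re (D y - D x) = 0" "Im (D y - D x) = of_int (2 * n) * pi"
          unfolding exp_eq_1 by blast
        with that have "n \<noteq> 0"
          by (auto simp: complex_eq_iff)
        then have "1 \<le> \<bar>real_of_int n\<bar>"
          by linarith
        then have "2 * pi \<le> \<bar>Im (D y - D x)\<bar>"
          unfolding n by (simp add: abs_mult)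
        also have "\<dots> \<le> norm (D y - D x)"
          by (rule abs_Im_le_cmod)
        finally show ?thesis .
      qed
      then show "\<exists>e>0. \<forall>y. y \<in> UNIV \<and> D y \<noteq> D x \<longrightarrow> e \<le> norm (D y - D x)"
        by (intro exI[of _ "2 * pi"]) auto
    qed auto
    then have "D u = D 0" for u
      by (metis UNIV_I constant_on_def)
    then show "L = (\<lambda>u. g u - g 0)"
      using L by (auto simp: D_def fun_eq_iff algebra_simps)
  qed
qed

lemma cont_log:
  assumes "is_chf f" "\<And>u. f u \<noteq> 0"
  shows "continuous_on UNIV (cont_log f)" "cont_log f 0 = 0" "exp (cont_log f u) = f u"
    and "0 \<le> Re (- cont_log f u)"
proof -
  obtain M where M: "real_distribution M" "char M = f"
    using assms(1) unfolding is_chf_def by blast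
  interpret real_distribution M by fact
  have "continuous_on UNIV f"
    using isCont_char M(2) by (simp add: continuous_at_imp_continuous_on)
  moreover have "f 0 = 1"
    using char_zero M(2) by simp
  ultimately have "\<exists>!L. continuous_on UNIV L \<and> L 0 = 0 \<and> (\<forall>u. exp (L u) = f u)"
    using assms(2) by (rule cont_log_ex1)
  from theI'[OF this] show *: "continuous_on UNIV (cont_log f)" "cont_log f 0 = 0"
      "exp (cont_log f u) = f u"
    unfolding cont_log_def by blast+
  have "exp (Re (cont_log f u)) \<le> 1"
    using cmod_char_le_1[of u] M(2) *(3) by (metis norm_exp_eq_Re)
  then show "0 \<le> Re (- cont_log f u)"
    by simp
qed

end

theory Submission
  imports Defs
begin

text \<open>By Levy's continuity theorem the law with characteristic function \<open>\<omega>\<^sup>s\<close> depends weakly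
  continuously, hence measurably, on \<open>s\<close>, so the mixture is the Giry-monad bind of a Markov kernel.
  Integrating \<open>exp (i u x)\<close> against it fibrewise gives
  \<open>\<integral> exp (s log \<omega>(u)) dG(s) = \<phi>(- log \<omega>(u))\<close>.\<close>

text \<open>The distribution function determines a law on the line. This turns the mixing measure
  built from \<open>G\<close> back into the law of \<open>Z\<close>.\<close>

lemma interval_measure_cdf:
  assumes "real_distribution M"
  shows "interval_measure (cdf M) = M"
proof (rule cdf_unique)
  interpret real_distribution M by fact
  note props = cdf_nondecreasing cdf_is_right_cont cdf_lim_at_bot cdf_lim_at_top_prob
  show "real_distribution (interval_measure (cdf M))"
    by (rule real_distribution_interval_measure) (fact props)+
  show "cdf (interval_measure (cdf M)) = cdf M"
    by (rule cdf_interval_measure) (fact props)+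
qed fact

text \<open>The ramp integral is squeezed between the values of \<open>cdf M\<close> at the two ends
  of the ramp, and right continuity closes the gap. The point is to reach the cdf through bounded
  continuous integrands, which weak convergence controls.\<close>

lemma (in real_distribution) integral_cts_step_LIMSEQ_cdf:
  "(\<lambda>n. integral\<^sup>L M (cts_step x (x + inverse (real (Suc n))))) \<longlonglongrightarrow> cdf M x"
proof (rule tendsto_sandwich[OF _ _ tendsto_const])
  have "filterlim (\<lambda>n. x + inverse (real (Suc n))) (at_right x) sequentially"
    unfolding filterlim_at
    by (auto intro!: LIMSEQ_inverse_real_of_nat_add simp del: of_nat_Suc)
  with cdf_is_right_cont[of x]
  show "(\<lambda>n. cdf M (x + inverse (real (Suc n)))) \<longlonglongrightarrow> cdf M x"
    unfolding continuous_within by (rule filterlim_compose)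
qed (auto intro!: always_eventually cdf_cts_step simp del: of_nat_Suc)

text \<open>Half-lines generate the Borel sets and are stable under intersection, so only
  \<open>cdf (K s) x\<close> has to be measurable in \<open>s\<close>. It may fail to be continuous
  where \<open>K s\<close> has an atom at \<open>x\<close>, but it is a pointwise limit of
  continuous ramp integrals.\<close>

lemma measurable_prob_algebra_if_continuous_char:
  fixes K :: "'a::{first_countable_topology, t2_space} \<Rightarrow> real measure"
  assumes K: "\<And>s. s \<in> S \<Longrightarrow> real_distribution (K s)"
    and cont: "\<And>t. continuous_on S (\<lambda>s. char (K s) t)"
  shows "K \<in> restrict_space borel S \<rightarrow>\<^sub>M prob_algebra borel"
proof (rule measurable_prob_algebra_generated)
  let ?R = "restrict_space borel S"
  show "sets borel = sigma_sets UNIV (range (\<lambda>a::real. {..a}))"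
    by (simp add: borel_eq_atMost)
  show "Int_stable (range (\<lambda>a::real. {..a}))"
    by (auto simp: Int_stable_def)
  fix A assume "A \<in> range (\<lambda>a::real. {..a})"
  then obtain x where A: "A = {..x}"
    by blast
  \<comment> \<open>Sequentially, convergence of the characteristic functions gives weak convergence
    by Levy; the ramp is continuous with values between 0 and 1.\<close>
  have "continuous_on S (\<lambda>s. integral\<^sup>L (K s) (cts_step x y))" if "x < y" for y
  proof (rule continuous_on_sequentiallyI)
    fix v s assume v: "\<forall>n. v n \<in> S" and s: "s \<in> S" and "v \<longlonglongrightarrow> s"
    then have "(\<lambda>n. char (K (v n)) t) \<longlonglongrightarrow> char (K s) t" for t
      using cont[of t] by (auto simp: continuous_on_sequentially comp_def)
    with v s have "weak_conv_m (\<lambda>n. K (v n)) (K s)"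
      by (intro levy_continuity K) auto
    with v s show "(\<lambda>n. integral\<^sup>L (K (v n)) (cts_step x y)) \<longlonglongrightarrow> integral\<^sup>L (K s) (cts_step x y)"
      using cts_step_uniformly_continuous[OF that, THEN uniformly_continuous_imp_continuous]
      by (intro weak_conv_imp_integral_bdd_continuous_conv[where B = 1] K)
         (auto simp: continuous_on_eq_continuous_at, auto simp: cts_step_def)
  qed
  then have meas: "(\<lambda>s. integral\<^sup>L (K s) (cts_step x (x + inverse (real (Suc n))))) \<in> borel_measurable ?R" for n
    by (intro borel_measurable_continuous_on_restrict) (simp del: of_nat_Suc)
  have "(\<lambda>s. cdf (K s) x) \<in> borel_measurable ?R"
    by (rule borel_measurable_LIMSEQ_real[OF real_distribution.integral_cts_step_LIMSEQ_cdf meas])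
       (simp add: space_restrict_space K)
  then have "(\<lambda>s. ennreal (cdf (K s) x)) \<in> borel_measurable ?R"
    by measurable
  also have "?this \<longleftrightarrow> (\<lambda>s. emeasure (K s) A) \<in> borel_measurable ?R"
  proof (rule measurable_cong)
    fix s assume "s \<in> space ?R"
    then interpret real_distribution "K s"
      by (intro K) (simp add: space_restrict_space)
    show "ennreal (cdf (K s) x) = emeasure (K s) A"
      by (simp add: A cdf_def emeasure_eq_measure)
  qed
  finally show "(\<lambda>s. emeasure (K s) A) \<in> borel_measurable ?R" .
qed (auto simp: space_restrict_space real_distribution.events_eq_borel[OF K]
      intro: real_distribution.axioms(1)[OF K])

lemma
  assumes "prob_space M" and K: "K \<in> M \<rightarrow>\<^sub>M prob_algebra borel"
  shows real_distribution_bind: "real_distribution (M \<bind> K)"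
    and char_bind: "char (M \<bind> K) u = (CLINT s|M. char (K s) u)"
proof -
  interpret prob_space M by fact
  have M: "M \<in> space (prob_algebra M)"
    using prob_space_axioms by (simp add: space_prob_algebra)
  show bind: "real_distribution (M \<bind> K)"
    using prob_space_bind'[OF M K] sets_bind'[OF M K]
    by (simp add: real_distribution_def real_distribution_axioms_def)
  have Ks: "real_distribution (K s)" if "s \<in> space M" for s
    using measurable_space[OF K that]
    by (simp add: space_prob_algebra real_distribution_def real_distribution_axioms_def)
  have K' [measurable]: "K \<in> M \<rightarrow>\<^sub>M subprob_algebra borel"
    using K by (rule measurable_prob_algebraD)
  \<comment> \<open>Fubini for the kernel, for real integrands; the complex exponential is covered
    below through its cosine and sine parts. \<open>B\<close> bounds the integrand and
    \<open>B'\<close> the mass of each \<open>K s\<close>.\<close>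
  have swap: "integral\<^sup>L (M \<bind> K) f = (\<integral>s. integral\<^sup>L (K s) f \<partial>M)"
    if "f \<in> borel_measurable borel" "\<And>x. \<bar>f x\<bar> \<le> 1" for f :: "real \<Rightarrow> real"
    using that K' finite_measure_axioms
    by (intro integral_bind[where K = borel and B = 1 and B' = 1])
       (auto intro!: AE_I2 simp: prob_space.emeasure_space_1[OF real_distribution.axioms(1)[OF Ks]])
  have int: "integrable N (\<lambda>x. iexp (u * x))" if "real_distribution N" for N
    using that by (intro prob_space.integrable_iexp) (auto simp: real_distribution_def
        real_distribution_axioms_def cong: measurable_cong_sets)
  have parts: "Re (char N u) = (\<integral>x. cos (u * x) \<partial>N)" "Im (char N u) = (\<integral>x. sin (u * x) \<partial>N)"
    if "real_distribution N" for N
    using int[OF that] unfolding char_def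
    by (simp_all flip: integral_Re integral_Im add: Re_exp Im_exp)
  have [measurable]: "(\<lambda>s. char (K s) u) \<in> borel_measurable M"
    unfolding char_def by measurable
  \<comment> \<open>Integrability lets \<open>Re\<close> and \<open>Im\<close> pass under the outer
    integral.\<close>
  have "integrable M (\<lambda>s. char (K s) u)"
    by (rule integrable_const_bound[where B = 1])
       (auto intro!: AE_I2 real_distribution.cmod_char_le_1 Ks)
  then have "Re (CLINT s|M. char (K s) u) = (\<integral>s. Re (char (K s) u) \<partial>M)"
    and "Im (CLINT s|M. char (K s) u) = (\<integral>s. Im (char (K s) u) \<partial>M)"
    by simp_all
  moreover have "(\<integral>s. Re (char (K s) u) \<partial>M) = (\<integral>s. \<integral>x. cos (u * x) \<partial>K s \<partial>M)"
    and "(\<integral>s. Im (char (K s) u) \<partial>M) = (\<integral>s. \<integral>x. sin (u * x) \<partial>K s \<partial>M)"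
    by (intro Bochner_Integration.integral_cong refl parts Ks; assumption)+
  ultimately show "char (M \<bind> K) u = (CLINT s|M. char (K s) u)"
    by (simp add: complex_eq_iff parts[OF bind] swap)
qed

theorem theorem2:
  fixes P :: "'a measure" and Z :: "'a \<Rightarrow> real" and G :: "real \<Rightarrow> real"
    and \<omega> :: "real \<Rightarrow> complex"
  assumes "prob_space P"
    and "Z \<in> borel_measurable P"
    and "AE x in P. Z x > 0"
    and "G = cdf (distr P borel Z)"
    and "infinitely_divisible_chf \<omega>"
  shows "real_distribution (mixture G (\<lambda>s. law_of_chf (chf_power \<omega> s)))
    \<and> char (mixture G (\<lambda>s. law_of_chf (chf_power \<omega> s)))
        = (\<lambda>u. laplace_transform P Z (- cont_log \<omega> u))"
proof -
  interpret prob_space P by fact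
  note [measurable] = assms(2)
  define D where "D = distr P borel Z"
  define K where "K s = law_of_chf (chf_power \<omega> s)" for s
  let ?R = "restrict_space D {0<..}"
  have K: "real_distribution (K s)" "char (K s) = chf_power \<omega> s" if "s > 0" for s
    using that assms(5) law_of_chf[of "chf_power \<omega> s"]
    by (auto simp: K_def infinitely_divisible_chf_def)
  have "real_distribution D"
    unfolding D_def by simp
  then have mix: "mixture G K = ?R \<bind> K"
    using assms(4) by (simp add: mixture_def D_def interval_measure_cdf)
  \<comment> \<open>Since \<open>Z\<close> is almost surely positive, restricting its law to the
    half-line loses no mass.\<close>
  have "emeasure D {0<..} = 1"
    using assms(3) by (simp add: D_def emeasure_distr emeasure_eq_1_AE)
  then have R: "prob_space ?R"
    by (intro prob_space_restrict_space) (simp_all add: D_def)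
  have "continuous_on {0<..} (\<lambda>s. char (K s) t)" for t
  proof -
    \<comment> \<open>For fixed \<open>t\<close> the logarithm is one constant, so this is the
      exponential of a linear function of \<open>s\<close>.\<close>
    have "continuous_on {0<..} (\<lambda>s. chf_power \<omega> s t)"
      unfolding chf_power_def by (intro continuous_intros)
    also have "?this \<longleftrightarrow> ?thesis"
      by (intro continuous_on_cong) (simp_all add: K)
    finally show ?thesis .
  qed
  then have "K \<in> restrict_space borel {0<..} \<rightarrow>\<^sub>M prob_algebra borel"
    by (intro measurable_prob_algebra_if_continuous_char K) auto
  also have "restrict_space borel {0<..} \<rightarrow>\<^sub>M prob_algebra borel = ?R \<rightarrow>\<^sub>M prob_algebra borel"
    by (intro measurable_cong_sets restrict_space_sets_cong refl) (simp add: D_def)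
  finally have KR: "K \<in> ?R \<rightarrow>\<^sub>M prob_algebra borel" .
  have "char (?R \<bind> K) u = laplace_transform P Z (- cont_log \<omega> u)" for u
  proof -
    have "char (?R \<bind> K) u = (CLINT s|?R. char (K s) u)"
      by (rule char_bind[OF R KR])
    also have "\<dots> = (CLINT s|?R. chf_power \<omega> s u)"
      by (intro Bochner_Integration.integral_cong) (auto simp: space_restrict_space K)
    \<comment> \<open>The indicator carries the restriction through the change of variables to
      \<open>P\<close>, where it equals 1 almost everywhere.\<close>
    also have "\<dots> = (CLINT s|D. indicator {0<..} s *\<^sub>R chf_power \<omega> s u)"
      by (rule integral_restrict_space) (simp add: D_def)
    also have "\<dots> = (CLINT x|P. indicator {0<..} (Z x) *\<^sub>R chf_power \<omega> (Z x) u)"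
      unfolding D_def chf_power_def by (rule integral_distr) measurable
    also have "\<dots> = (CLINT x|P. chf_power \<omega> (Z x) u)"
      using assms(3) by (intro integral_cong_AE) (auto simp: chf_power_def)
    \<comment> \<open>The two minus signs cancel. By \<open>cont_log\<close> the argument has
      nonnegative real part, so the integrand has modulus at most 1 almost everywhere and the
      integral is a genuine one, not the default 0.\<close>
    also have "\<dots> = laplace_transform P Z (- cont_log \<omega> u)"
      by (simp add: laplace_transform_def chf_power_def mult.commute)
    finally show ?thesis .
  qed
  with real_distribution_bind[OF R KR] show ?thesis
    unfolding K_def[symmetric] mix by auto
qed

end
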